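(* Let $K$ be a field of characteristic $\ne2$ and let $N$ be an indecomposable power-associative nil evolution $K$-algebra of dimension $\le 6$ which is not associative and satisfies $\dim(\mathrm{ann}(N))=2$, written in a natural basis $\{e_1,\dots,e_6\}$ in one of the two normal forms $N_{6,25}(\alpha)$, $N_{6,26}$ listed in the context. Then the derivations of $N$ are exactly the linear maps $d$ of the following form, where the scalars $d_{ji}\in K$ that appear are arbitrary, and $\mathfrak{D}(N)$ is, as a vector space, as indicated: (1) $N_{6,25}(\alpha)$: $d(e_1)=d_{11}e_1+d_{51}e_5+d_{61}e_6$, $d(e_2)=d_{22}e_2+(2d_{11}-d_{22})e_3+d_{52}e_5+d_{62}e_6$, $d(e_3)=(2d_{11}-d_{22})e_2+d_{22}e_3-d_{52}e_5-d_{62}e_6$, $d(e_4)=d_{11}e_4+d_{54}e_5+d_{64}e_6$, $d(e_5)=2d_{22}e_5$, $d(e_6)=2d_{11}e_6$; $\mathfrak{D}(N)\simeq K^5\times K^3$. (2) $N_{6,26}$: $d(e_1)=d_{11}e_1+d_{51}e_5+d_{61}e_6$, $d(e_2)=2d_{11}e_2+d_{52}e_5+d_{62}e_6$, $d(e_3)=2d_{11}e_3+d_{53}e_5+d_{63}e_6$, $d(e_4)=2d_{11}e_4-(d_{52}+d_{53})e_5-(d_{62}+d_{63})e_6$, $d(e_5)=4d_{11}e_5$, $d(e_6)=4d_{11}e_6$; $\mathfrak{D}(N)\simeq K^4\times K^3$.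
   Context: An evolution $K$-algebra is a finite-dimensional commutative (not necessarily associative) $K$-algebra with a basis $\{e_1,\dots,e_n\}$ (a natural basis) such that $e_ie_j=0$ for $i\neq j$. It is power-associative if every subalgebra generated by one element is associative; nil if for every $a$ some power $a^m$ is $0$; indecomposable if it is not a direct sum of two nonzero ideals; $\mathrm{ann}(N)=\{x\in N:xN=0\}$. $\mathfrak{D}(N)$ is the space of derivations, i.e. linear maps $d:N\to N$ with $d(uv)=ud(v)+d(u)v$. Known classification (from earlier work, to be taken as given): every non-associative indecomposable power-associative nil evolution algebra of dimension $\le6$ with two-dimensional annihilator is isomorphic to one of the following ($e_ie_j=0$ for $i\neq j$): - $N_{6,25}(\alpha)$: $e_1^2=e_2+e_3$, $e_2^2=e_5$, $e_3^2=-e_5$, $e_4^2=\alpha(e_2+e_3)+e_6$, $e_5^2=e_6^2=0$, with $\alpha\in K^*$. - $N_{6,26}$: $e_1^2=e_2+e_3+e_4$, $e_2^2=e_5$, $e_3^2=e_6$, $e_4^2=-(e_5+e_6)$, $e_5^2=e_6^2=0$. *)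

theory Defs
  imports "HOL-Analysis.Analysis" "HOL-Library.Function_Algebras"
begin

text \<open>The algebra is the whole type \<^typ>\<open>'a\<close>, with scalar multiplication \<open>scale\<close> and
  product \<open>mult\<close>. Right distributivity follows from commutativity.\<close>

locale commutative_algebra = vector_space scale
  for scale :: "'k::field \<Rightarrow> 'a::ab_group_add \<Rightarrow> 'a" (infixr "\<cdot>" 75) +
  fixes mult :: "'a \<Rightarrow> 'a \<Rightarrow> 'a" (infixl "\<odot>" 70)
  assumes mult_commute: "x \<odot> y = y \<odot> x"
    and mult_add_left: "(x + y) \<odot> z = x \<odot> z + y \<odot> z"
    and mult_scale_left: "(c \<cdot> x) \<odot> y = c \<cdot> (x \<odot> y)"
begin

definition natural_basis :: "'a set \<Rightarrow> bool" where
  "natural_basis B \<longleftrightarrow> finite B \<and> independent B \<and> span B = UNIV \<and>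
     (\<forall>u\<in>B. \<forall>v\<in>B. u \<noteq> v \<longrightarrow> u \<odot> v = 0)"

definition evolution :: bool where
  "evolution \<longleftrightarrow> (\<exists>B. natural_basis B)"

definition subalgebra :: "'a set \<Rightarrow> bool" where
  "subalgebra S \<longleftrightarrow> subspace S \<and> (\<forall>x\<in>S. \<forall>y\<in>S. x \<odot> y \<in> S)"

definition associative_on :: "'a set \<Rightarrow> bool" where
  "associative_on S \<longleftrightarrow> (\<forall>x\<in>S. \<forall>y\<in>S. \<forall>z\<in>S. (x \<odot> y) \<odot> z = x \<odot> (y \<odot> z))"

definition power_associative :: bool where
  "power_associative \<longleftrightarrow> (\<forall>a. associative_on (subalgebra hull {a}))"

text \<open>Principal powers, shifted by one because there need not be a unit:
  \<open>principal_power_Suc a m\<close> stands for $a^{m+1}$, where $a^1 = a$ and $a^{k+1} = a\,a^k$.\<close>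

primrec principal_power_Suc :: "'a \<Rightarrow> nat \<Rightarrow> 'a" where
  "principal_power_Suc a 0 = a"
| "principal_power_Suc a (Suc m) = a \<odot> principal_power_Suc a m"

definition nil :: bool where
  "nil \<longleftrightarrow> (\<forall>a. \<exists>m. principal_power_Suc a m = 0)"

definition is_ideal :: "'a set \<Rightarrow> bool" where
  "is_ideal I \<longleftrightarrow> subspace I \<and> (\<forall>x. \<forall>y\<in>I. x \<odot> y \<in> I)"

definition indecomposable :: bool where
  "indecomposable \<longleftrightarrow>
     \<not> (\<exists>I J. is_ideal I \<and> is_ideal J \<and> I \<noteq> {0} \<and> J \<noteq> {0} \<and>
              I \<inter> J = {0} \<and> (\<forall>x. \<exists>u\<in>I. \<exists>v\<in>J. x = u + v))"

definition ann :: "'a set" where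
  "ann = {x. \<forall>y. x \<odot> y = 0}"

definition derivations :: "('a \<Rightarrow> 'a) set" where
  "derivations = {d. Vector_Spaces.linear scale scale d \<and>
                     (\<forall>u v. d (u \<odot> v) = u \<odot> d v + d u \<odot> v)}"

definition normal_form_6_25 :: "'k \<Rightarrow> (nat \<Rightarrow> 'a) \<Rightarrow> bool" where
  "normal_form_6_25 \<alpha> e \<longleftrightarrow> \<alpha> \<noteq> 0 \<and> inj_on e {1..6} \<and> natural_basis (e ` {1..6}) \<and>
     e 1 \<odot> e 1 = e 2 + e 3 \<and>
     e 2 \<odot> e 2 = e 5 \<and>
     e 3 \<odot> e 3 = - e 5 \<and>
     e 4 \<odot> e 4 = \<alpha> \<cdot> (e 2 + e 3) + e 6 \<and>
     e 5 \<odot> e 5 = 0 \<and>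
     e 6 \<odot> e 6 = 0"

definition normal_form_6_26 :: "(nat \<Rightarrow> 'a) \<Rightarrow> bool" where
  "normal_form_6_26 e \<longleftrightarrow> inj_on e {1..6} \<and> natural_basis (e ` {1..6}) \<and>
     e 1 \<odot> e 1 = e 2 + e 3 + e 4 \<and>
     e 2 \<odot> e 2 = e 5 \<and>
     e 3 \<odot> e 3 = e 6 \<and>
     e 4 \<odot> e 4 = - (e 5 + e 6) \<and>
     e 5 \<odot> e 5 = 0 \<and>
     e 6 \<odot> e 6 = 0"

end

text \<open>Scalar multiplication on \<open>K^m \<times> K^n\<close> and, pointwise, on maps into a vector space; the
  additive structures are those of the library's type class instances.\<close>

definition scale_prod :: "'k::field \<Rightarrow> ('k^'m) \<times> ('k^'n) \<Rightarrow> ('k^'m) \<times> ('k^'n)" where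
  "scale_prod c p = (c *s fst p, c *s snd p)"

definition scale_fun :: "('k \<Rightarrow> 'a \<Rightarrow> 'a) \<Rightarrow> 'k \<Rightarrow> ('b \<Rightarrow> 'a) \<Rightarrow> 'b \<Rightarrow> 'a" where
  "scale_fun s c f = (\<lambda>x. s c (f x))"

end

theory Submission
  imports Defs
begin

text \<open>Both sides of the Leibniz rule are bilinear, so a linear map \<open>d\<close> is a derivation as soon as
  the rule holds on a natural basis. There it becomes a system of linear equations in the matrix
  entries \<open>d\<^sub>i\<^sub>j\<close> of \<open>d\<close>, because \<open>e\<^sub>i \<odot> x\<close> only sees the \<open>i\<close>-th coordinate of \<open>x\<close>: distinct
  indices give \<open>d\<^sub>i\<^sub>j e\<^sub>i\<^sup>2 + d\<^sub>j\<^sub>i e\<^sub>j\<^sup>2 = 0\<close>, and equal indices give \<open>d(e\<^sub>i\<^sup>2) = 2 d\<^sub>i\<^sub>i e\<^sub>i\<^sup>2\<close>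
  (\<open>derivation_iff\<close>).

  In the two normal forms \<open>e\<^sub>1\<^sup>2, \<dots>, e\<^sub>4\<^sup>2\<close> are nonzero and almost all pairs of them are linearly
  independent. The first family of equations therefore kills nearly every off-diagonal entry; the
  exception is the pair \<open>e\<^sub>2\<^sup>2 = - e\<^sub>3\<^sup>2\<close> of the first algebra, which only yields \<open>d\<^sub>2\<^sub>3 = d\<^sub>3\<^sub>2\<close>. This
  family leaves the entries \<open>d\<^sub>5\<^sub>j\<close> and \<open>d\<^sub>6\<^sub>j\<close> alone, because \<open>e\<^sub>5\<^sup>2 = e\<^sub>6\<^sup>2 = 0\<close>. The second family
  relates the diagonal entries, balances \<open>d\<^sub>5\<^sub>j\<close> and \<open>d\<^sub>6\<^sub>j\<close> over the \<open>e\<^sub>j\<close> that occur in \<open>e\<^sub>1\<^sup>2\<close>,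
  and determines \<open>d(e\<^sub>5)\<close> and \<open>d(e\<^sub>6)\<close>. The characteristic enters through \<open>d\<^sub>4\<^sub>4 = d\<^sub>1\<^sub>1\<close> in the
  first algebra, which arises as \<open>2 \<alpha> d\<^sub>1\<^sub>1 = 2 \<alpha> d\<^sub>4\<^sub>4\<close>.

  For the vector space structure, linear maps correspond to arbitrary choices of the images of the
  basis. The description above writes these images as linear, injective functions of the free
  scalars, eight of them in the first case and seven in the second, which gives a linear bijection
  from the space of scalars to the derivations (\<open>parametrization_bij\<close>).\<close>

section \<open>Coordinates with respect to a natural basis\<close>

locale evolution_basis = commutative_algebra scale mult
  for scale :: "'k::field \<Rightarrow> 'a::ab_group_add \<Rightarrow> 'a" (infixr "\<cdot>" 75)
    and mult :: "'a \<Rightarrow> 'a \<Rightarrow> 'a" (infixl "\<odot>" 70) +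
  fixes I :: "'i set" and e :: "'i \<Rightarrow> 'a"
  assumes inj_e: "inj_on e I"
    and natural_basis_e: "natural_basis (e ` I)"
begin

lemma
  shows finite_index: "finite I"
    and independent_e: "independent (e ` I)"
    and span_e: "span (e ` I) = UNIV"
    and mult_e_distinct: "\<lbrakk>i \<in> I; j \<in> I; i \<noteq> j\<rbrakk> \<Longrightarrow> e i \<odot> e j = 0"
  using natural_basis_e inj_e
  by (auto simp: natural_basis_def inj_on_eq_iff dest: finite_imageD)

definition coord :: "'i \<Rightarrow> 'a \<Rightarrow> 'k" where
  "coord i x = representation (e ` I) x (e i)"

lemma coord_add: "coord i (x + y) = coord i x + coord i y"
  and coord_diff: "coord i (x - y) = coord i x - coord i y"
  and coord_uminus: "coord i (- x) = - coord i x"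
  and coord_scale: "coord i (c \<cdot> x) = c * coord i x"
  and coord_zero: "coord i 0 = 0"
  using independent_e span_e
  by (simp_all add: coord_def representation_add representation_diff representation_neg
      representation_scale representation_zero)

lemma coord_e: "\<lbrakk>i \<in> I; j \<in> I\<rbrakk> \<Longrightarrow> coord i (e j) = (if i = j then 1 else 0)"
  using independent_e inj_e
  by (simp add: coord_def representation_basis inj_on_eq_iff)

lemmas coord_simps = coord_add coord_diff coord_uminus coord_scale coord_zero coord_e

lemma sum_coord: "(\<Sum>i\<in>I. coord i x \<cdot> e i) = x"
proof -
  have "(\<Sum>b\<in>e ` I. representation (e ` I) x b \<cdot> b) = x"
    using independent_e span_e finite_index by (intro sum_representation_eq) auto
  then show ?thesis
    by (simp add: sum.reindex[OF inj_e] coord_def)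
qed

lemma mult_add_right: "x \<odot> (y + z) = x \<odot> y + x \<odot> z"
  by (metis mult_commute mult_add_left)

lemma mult_scale_right: "x \<odot> (c \<cdot> y) = c \<cdot> (x \<odot> y)"
  by (metis mult_commute mult_scale_left)

lemma mult_zero_left: "0 \<odot> x = 0"
  using mult_scale_left[of 0 0 x] by simp

lemma mult_zero_right: "x \<odot> 0 = 0"
  using mult_zero_left[of x] by (simp add: mult_commute)

lemma mult_sum_right: "x \<odot> (\<Sum>j\<in>A. f j) = (\<Sum>j\<in>A. x \<odot> f j)"
  by (induction A rule: infinite_finite_induct) (simp_all add: mult_zero_right mult_add_right)

text \<open>Multiplication by a basis vector annihilates all the other basis vectors. This is what makes
  the Leibniz rule on the basis tractable.\<close>

lemma mult_e_left:
  assumes "i \<in> I" shows "e i \<odot> x = coord i x \<cdot> (e i \<odot> e i)"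
proof -
  have "e i \<odot> x = (\<Sum>j\<in>I. coord j x \<cdot> (e i \<odot> e j))"
    by (subst sum_coord[of x, symmetric]) (simp add: mult_sum_right mult_scale_right)
  also have "\<dots> = (\<Sum>j\<in>I. if j = i then coord i x \<cdot> (e i \<odot> e i) else 0)"
    using assms by (intro sum.cong) (auto simp: mult_e_distinct)
  finally show ?thesis using assms finite_index by simp
qed

section \<open>Derivations on a natural basis\<close>

text \<open>For a fixed argument, the vectors satisfying the Leibniz rule in the other argument form a
  subspace. Hence the rule spreads from the basis to its span, one argument at a time.\<close>

lemma derivation_iff_on_basis:
  assumes "Vector_Spaces.linear scale scale d"
  shows "d \<in> derivations \<longleftrightarrow>
    (\<forall>i\<in>I. \<forall>j\<in>I. d (e i \<odot> e j) = e i \<odot> d (e j) + d (e i) \<odot> e j)"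
proof
  interpret d: Vector_Spaces.linear scale scale d by fact
  assume basis: "\<forall>i\<in>I. \<forall>j\<in>I. d (e i \<odot> e j) = e i \<odot> d (e j) + d (e i) \<odot> e j"
  let ?P = "\<lambda>u v. d (u \<odot> v) = u \<odot> d v + d u \<odot> v"
  have left: "subspace {u. ?P u v}" for v
    by (rule subspaceI)
      (auto simp: mult_zero_left d.zero mult_add_left d.add mult_scale_left d.scale
        scale_right_distrib algebra_simps)
  have right: "subspace {v. ?P u v}" for u
    by (rule subspaceI)
      (auto simp: mult_zero_right d.zero mult_add_right d.add mult_scale_right d.scale
        scale_right_distrib algebra_simps)
  have "?P u v" for u v
  proof -
    have "?P u (e j)" if "j \<in> I" for j
      using span_induct[OF _ left, of u "e ` I" "e j"] basis that span_e by auto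
    then show ?thesis
      using span_induct[OF _ right, of v "e ` I" u] span_e by auto
  qed
  then show "d \<in> derivations" using assms by (simp add: derivations_def)
qed (simp add: derivations_def)

lemma derivation_iff:
  assumes "Vector_Spaces.linear scale scale d"
  shows "d \<in> derivations \<longleftrightarrow>
    (\<forall>i\<in>I. d (e i \<odot> e i) = (2 * coord i (d (e i))) \<cdot> (e i \<odot> e i)) \<and>
    (\<forall>i\<in>I. \<forall>j\<in>I. i \<noteq> j \<longrightarrow>
       coord i (d (e j)) \<cdot> (e i \<odot> e i) + coord j (d (e i)) \<cdot> (e j \<odot> e j) = 0)"
proof -
  interpret d: Vector_Spaces.linear scale scale d by fact
  have leibniz: "e i \<odot> d (e j) + d (e i) \<odot> e j =
      coord i (d (e j)) \<cdot> (e i \<odot> e i) + coord j (d (e i)) \<cdot> (e j \<odot> e j)"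
    if "i \<in> I" "j \<in> I" for i j
    using that mult_e_left[of i "d (e j)"] mult_e_left[of j "d (e i)"] mult_commute[of "d (e i)" "e j"]
    by simp
  have diag: "c \<cdot> x + c \<cdot> x = (2 * c) \<cdot> x" for c x
    by (simp add: scale_left_distrib[symmetric])
  have "(d (e i \<odot> e j) = e i \<odot> d (e j) + d (e i) \<odot> e j) \<longleftrightarrow>
     (if i = j then d (e i \<odot> e i) = (2 * coord i (d (e i))) \<cdot> (e i \<odot> e i)
      else coord i (d (e j)) \<cdot> (e i \<odot> e i) + coord j (d (e i)) \<cdot> (e j \<odot> e j) = 0)"
    if "i \<in> I" "j \<in> I" for i j
    using that by (auto simp: leibniz diag mult_e_distinct d.zero)
  then show ?thesis unfolding derivation_iff_on_basis[OF assms] by auto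
qed

text \<open>The coordinatewise forms of the two families of equations, from which the matrix entries of a
  given derivation are read off.\<close>

lemma derivation_square_coord:
  assumes "d \<in> derivations" "i \<in> I"
  shows "coord k (d (e i \<odot> e i)) = 2 * coord i (d (e i)) * coord k (e i \<odot> e i)"
proof -
  have "d (e i \<odot> e i) = (2 * coord i (d (e i))) \<cdot> (e i \<odot> e i)"
    using assms derivation_iff[of d] unfolding derivations_def by blast
  then show ?thesis by (simp add: coord_scale)
qed

lemma derivation_offdiag_coord:
  assumes "d \<in> derivations" "i \<in> I" "j \<in> I" "i \<noteq> j"
  shows "coord i (d (e j)) * coord k (e i \<odot> e i) + coord j (d (e i)) * coord k (e j \<odot> e j) = 0"
proof -
  have "coord i (d (e j)) \<cdot> (e i \<odot> e i) + coord j (d (e i)) \<cdot> (e j \<odot> e j) = 0"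
    using assms derivation_iff[of d] unfolding derivations_def by blast
  then show ?thesis by (metis coord_add coord_scale coord_zero)
qed

text \<open>The parameter \<open>p\<close> is sent to the linear map with \<open>e i \<mapsto> f p i\<close>. It depends linearly on \<open>p\<close>
  because the \<open>f p i\<close> do, it determines \<open>p\<close> by \<open>f_inj\<close>, and it exhausts \<open>D\<close> because a linear map
  is determined by its values on a basis.\<close>

lemma parametrization_bij:
  assumes "vector_space sp"
    and f_add: "\<And>p q i. i \<in> I \<Longrightarrow> f (p + q) i = f p i + f q i"
    and f_scale: "\<And>c p i. i \<in> I \<Longrightarrow> f (sp c p) i = c \<cdot> f p i"
    and f_inj: "\<And>p q. \<forall>i\<in>I. f p i = f q i \<Longrightarrow> p = q"
    and D: "\<And>d. d \<in> D \<longleftrightarrow>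
      Vector_Spaces.linear scale scale d \<and> (\<exists>p. \<forall>i\<in>I. d (e i) = f p i)"
  shows "\<exists>\<phi>. Vector_Spaces.linear sp (scale_fun scale) \<phi> \<and> bij_betw \<phi> UNIV D"
proof -
  define \<phi> where "\<phi> p x = (\<Sum>i\<in>I. coord i x \<cdot> f p i)" for p x
  have \<phi>_e: "\<phi> p (e i) = f p i" if "i \<in> I" for p i
  proof -
    have "\<phi> p (e i) = (\<Sum>j\<in>I. if j = i then f p i else 0)"
      unfolding \<phi>_def using that by (intro sum.cong) (auto simp: coord_e)
    then show ?thesis using that finite_index by simp
  qed
  have \<phi>_linear: "Vector_Spaces.linear scale scale (\<phi> p)" for p
    by (simp add: Vector_Spaces.linear_iff vector_space_axioms \<phi>_def coord_add coord_scale
        scale_left_distrib sum.distrib scale_sum_right)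
  have determined: "d = \<phi> p"
    if d: "Vector_Spaces.linear scale scale d" and "\<forall>i\<in>I. d (e i) = f p i" for d p
  proof
    fix x
    interpret d: Vector_Spaces.linear scale scale d by fact
    have "d x = d (\<Sum>i\<in>I. coord i x \<cdot> e i)" by (simp add: sum_coord)
    also have "\<dots> = \<phi> p x" using that by (simp add: d.sum d.scale \<phi>_def)
    finally show "d x = \<phi> p x" .
  qed
  have "vector_space (scale_fun scale :: 'k \<Rightarrow> ('a \<Rightarrow> 'a) \<Rightarrow> 'a \<Rightarrow> 'a)"
    by unfold_locales
      (auto simp: scale_fun_def fun_eq_iff scale_left_distrib scale_right_distrib)
  then have "Vector_Spaces.linear sp (scale_fun scale) \<phi>"
    using assms(1)
    by (auto simp: Vector_Spaces.linear_iff fun_eq_iff \<phi>_def scale_fun_def f_add f_scale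
        scale_right_distrib sum.distrib scale_sum_right mult.commute)
  moreover have "inj \<phi>"
    by (rule injI, rule f_inj) (metis \<phi>_e)
  moreover have "range \<phi> = D"
    using D \<phi>_linear \<phi>_e determined by blast
  ultimately show ?thesis by (auto simp: bij_betw_def)
qed

end

section \<open>The parameter space\<close>

lemma vector_space_scale_prod:
  "vector_space (scale_prod :: 'k::field \<Rightarrow> ('k^'m) \<times> ('k^'n) \<Rightarrow> _)"
  by unfold_locales
    (auto simp: scale_prod_def vector_add_ldistrib vector_sadd_rdistrib vector_smult_assoc)

lemma exhaust_5: "(x::5) = 1 \<or> x = 2 \<or> x = 3 \<or> x = 4 \<or> x = 5"
proof (induct x)
  case (of_int z)
  then have "z = 0 \<or> z = 1 \<or> z = 2 \<or> z = 3 \<or> z = 4" by auto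
  then show ?case by auto
qed

lemma forall_5: "(\<forall>i::5. P i) \<longleftrightarrow> P 1 \<and> P 2 \<and> P 3 \<and> P 4 \<and> P 5"
  by (metis exhaust_5)

lemma vec_eq_iff_5:
  "(v::'k^5) = w \<longleftrightarrow> v$1 = w$1 \<and> v$2 = w$2 \<and> v$3 = w$3 \<and> v$4 = w$4 \<and> v$5 = w$5"
  by (simp add: vec_eq_iff forall_5)

lemma vec_eq_iff_4:
  "(v::'k^4) = w \<longleftrightarrow> v$1 = w$1 \<and> v$2 = w$2 \<and> v$3 = w$3 \<and> v$4 = w$4"
  by (simp add: vec_eq_iff forall_4)

lemma vec_eq_iff_3: "(v::'k^3) = w \<longleftrightarrow> v$1 = w$1 \<and> v$2 = w$2 \<and> v$3 = w$3"
  by (simp add: vec_eq_iff forall_3)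

lemma ex_vec_5: "\<exists>v::'k^5. v$1 = a \<and> v$2 = b \<and> v$3 = c \<and> v$4 = d \<and> v$5 = f"
  by (rule exI[of _ "\<chi> i. if i = 1 then a else if i = 2 then b else if i = 3 then c
    else if i = 4 then d else f"]) simp

lemma ex_vec_4: "\<exists>v::'k^4. v$1 = a \<and> v$2 = b \<and> v$3 = c \<and> v$4 = d"
  by (rule exI[of _ "\<chi> i. if i = 1 then a else if i = 2 then b else if i = 3 then c else d"]) simp

lemma ex_vec_3: "\<exists>v::'k^3. v$1 = a \<and> v$2 = b \<and> v$3 = c"
  by (rule exI[of _ "\<chi> i. if i = 1 then a else if i = 2 then b else c"]) simp

section \<open>The two normal forms\<close>

lemma sum_1_6: "(\<Sum>i\<in>{1..6::nat}. f i) = f 1 + f 2 + f 3 + f 4 + f 5 + f 6"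
  for f :: "nat \<Rightarrow> 'b::comm_monoid_add"
proof -
  have "{1..6::nat} = {1, 2, 3, 4, 5, 6}" by auto
  then show ?thesis by (simp add: add.assoc)
qed

lemma ball_1_6: "(\<forall>i\<in>{1..6::nat}. P i) \<longleftrightarrow> P 1 \<and> P 2 \<and> P 3 \<and> P 4 \<and> P 5 \<and> P 6"
proof -
  have "{1..6::nat} = {1, 2, 3, 4, 5, 6}" by auto
  then show ?thesis by simp
qed

context commutative_algebra
begin

text \<open>Below, \<open>a i j\<close> is the matrix entry \<open>d\<^sub>i\<^sub>j\<close>. Each instance of \<open>off\<close> or \<open>diag\<close> is taken at a
  coordinate where the squares involved differ: coordinate \<open>6\<close> isolates \<open>e\<^sub>4\<^sup>2\<close> from \<open>e\<^sub>1\<^sup>2\<close>, for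
  example.\<close>

lemma derivations_6_25:
  assumes nf: "normal_form_6_25 \<alpha> e" and two: "(2::'k) \<noteq> 0"
    and lin: "Vector_Spaces.linear scale scale d"
  shows "d \<in> derivations \<longleftrightarrow>
    (\<exists>d11 d22 d51 d61 d52 d62 d54 d64.
      d (e 1) = d11 \<cdot> e 1 + d51 \<cdot> e 5 + d61 \<cdot> e 6 \<and>
      d (e 2) = d22 \<cdot> e 2 + (2 * d11 - d22) \<cdot> e 3 + d52 \<cdot> e 5 + d62 \<cdot> e 6 \<and>
      d (e 3) = (2 * d11 - d22) \<cdot> e 2 + d22 \<cdot> e 3 - d52 \<cdot> e 5 - d62 \<cdot> e 6 \<and>
      d (e 4) = d11 \<cdot> e 4 + d54 \<cdot> e 5 + d64 \<cdot> e 6 \<and>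
      d (e 5) = (2 * d22) \<cdot> e 5 \<and>
      d (e 6) = (2 * d11) \<cdot> e 6)" (is "_ \<longleftrightarrow> ?form")
proof -
  interpret evolution_basis scale mult "{1..6::nat}" e
    using nf by unfold_locales (simp_all add: normal_form_6_25_def)
  interpret d: Vector_Spaces.linear scale scale d by fact
  have \<alpha>: "\<alpha> \<noteq> 0" and sq:
    "e 1 \<odot> e 1 = e 2 + e 3" "e 2 \<odot> e 2 = e 5" "e 3 \<odot> e 3 = - e 5"
    "e 4 \<odot> e 4 = \<alpha> \<cdot> (e 2 + e 3) + e 6" "e 5 \<odot> e 5 = 0" "e 6 \<odot> e 6 = 0"
    using nf by (auto simp: normal_form_6_25_def)
  \<comment> \<open>Keeps the index in \<open>e 1\<close> from being rewritten to \<open>Suc 0\<close>, which the facts below would not match.\<close>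
  note One_nat_def [simp del]
  note calc = sq coord_simps d.add d.neg d.scale d.zero
  define a where "a i j = coord i (d (e j))" for i j
  have expand: "d (e j) = a 1 j \<cdot> e 1 + a 2 j \<cdot> e 2 + a 3 j \<cdot> e 3 + a 4 j \<cdot> e 4
      + a 5 j \<cdot> e 5 + a 6 j \<cdot> e 6" for j
    using sum_coord[of "d (e j)"] by (simp add: sum_1_6 a_def)
  show ?thesis
  proof
    assume der: "d \<in> derivations"
    have diag: "coord k (d (e i \<odot> e i)) = 2 * a i i * coord k (e i \<odot> e i)"
      if "i \<in> {1..6}" for i k
      using derivation_square_coord[OF der that] by (simp only: a_def)
    have off: "a i j * coord k (e i \<odot> e i) + a j i * coord k (e j \<odot> e j) = 0"
      if "i \<in> {1..6}" "j \<in> {1..6}" "i \<noteq> j" for i j k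
      using derivation_offdiag_coord[OF der that] by (simp only: a_def)
    have z1: "a 1 2 = 0" "a 2 1 = 0" "a 1 3 = 0" "a 3 1 = 0" "a 1 4 = 0" "a 4 1 = 0"
      "a 1 5 = 0" "a 1 6 = 0"
      using off[of 1 2 2] off[of 1 2 5] off[of 1 3 2] off[of 1 3 5] off[of 1 4 2] off[of 1 4 6]
        off[of 1 5 2] off[of 1 6 2] by (simp_all add: calc)
    have z2: "a 2 3 = a 3 2" "a 2 4 = 0" "a 4 2 = 0" "a 2 5 = 0" "a 2 6 = 0"
      using off[of 2 3 5] off[of 2 4 5] off[of 2 4 6] off[of 2 5 5] off[of 2 6 5]
      by (simp_all add: calc)
    have z3: "a 3 4 = 0" "a 4 3 = 0" "a 3 5 = 0" "a 3 6 = 0" "a 4 5 = 0" "a 4 6 = 0"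
      using off[of 3 4 5] off[of 3 4 6] off[of 3 5 5] off[of 3 6 5] off[of 4 5 6] off[of 4 6 6]
      by (simp_all add: calc)
    have r1: "a 2 2 + a 2 3 = 2 * a 1 1" "a 3 2 + a 3 3 = 2 * a 1 1"
      "a 5 3 = - a 5 2" "a 6 3 = - a 6 2"
      using diag[of 1 2] diag[of 1 3] diag[of 1 5] diag[of 1 6]
      by (simp_all add: calc a_def[symmetric] eq_neg_iff_add_eq_0 add.commute)
    have r2: "a 5 5 = 2 * a 2 2" "a 6 5 = 0"
      using diag[of 2 5] diag[of 2 6] by (simp_all add: calc a_def[symmetric])
    have r4: "\<alpha> * (a 2 2 + a 2 3) + a 2 6 = 2 * a 4 4 * \<alpha>" "\<alpha> * (a 5 2 + a 5 3) + a 5 6 = 0"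
      "\<alpha> * (a 6 2 + a 6 3) + a 6 6 = 2 * a 4 4"
      using diag[of 4 2] diag[of 4 5] diag[of 4 6]
      by (simp_all add: calc a_def[symmetric] algebra_simps)
    \<comment> \<open>The characteristic and \<open>\<alpha> \<noteq> 0\<close> matter here: the common factor \<open>2 * \<alpha>\<close> is cancelled.\<close>
    have "\<alpha> * (a 2 2 + a 2 3) = \<alpha> * (2 * a 4 4)"
      using r4(1) z2(4,5) by (metis add.right_neutral mult.commute)
    then have a44: "a 4 4 = a 1 1"
      using \<alpha> two r1(1) by simp
    have a3: "a 3 2 = 2 * a 1 1 - a 2 2"
      using r1(1) z2(1) by (simp add: algebra_simps)
    have a33: "a 3 3 = a 2 2"
      using r1(2) a3 by simp
    have a6: "a 5 6 = 0" "a 6 6 = 2 * a 1 1"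
      using r4 r1 a44 by simp_all
    show ?form
    proof (intro exI conjI)
      show "d (e 1) = a 1 1 \<cdot> e 1 + a 5 1 \<cdot> e 5 + a 6 1 \<cdot> e 6"
        by (simp add: expand z1)
      show "d (e 2) = a 2 2 \<cdot> e 2 + (2 * a 1 1 - a 2 2) \<cdot> e 3 + a 5 2 \<cdot> e 5 + a 6 2 \<cdot> e 6"
        by (simp add: expand z1 z2 a3)
      show "d (e 3) = (2 * a 1 1 - a 2 2) \<cdot> e 2 + a 2 2 \<cdot> e 3 - a 5 2 \<cdot> e 5 - a 6 2 \<cdot> e 6"
        by (simp add: expand z1 z2 z3 r1 a3 a33)
      show "d (e 4) = a 1 1 \<cdot> e 4 + a 5 4 \<cdot> e 5 + a 6 4 \<cdot> e 6"
        by (simp add: expand z1 z2 z3 a44)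
      show "d (e 5) = (2 * a 2 2) \<cdot> e 5"
        by (simp add: expand z1 z2 z3 r2)
      show "d (e 6) = (2 * a 1 1) \<cdot> e 6"
        by (simp add: expand z1 z2 z3 a6)
    qed
  next
    assume ?form
    then obtain d11 d22 d51 d61 d52 d62 d54 d64 where form:
      "d (e 1) = d11 \<cdot> e 1 + d51 \<cdot> e 5 + d61 \<cdot> e 6"
      "d (e 2) = d22 \<cdot> e 2 + (2 * d11 - d22) \<cdot> e 3 + d52 \<cdot> e 5 + d62 \<cdot> e 6"
      "d (e 3) = (2 * d11 - d22) \<cdot> e 2 + d22 \<cdot> e 3 - d52 \<cdot> e 5 - d62 \<cdot> e 6"
      "d (e 4) = d11 \<cdot> e 4 + d54 \<cdot> e 5 + d64 \<cdot> e 6"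
      "d (e 5) = (2 * d22) \<cdot> e 5" "d (e 6) = (2 * d11) \<cdot> e 6"
      by blast
    \<comment> \<open>The image of \<open>e 2 + e 3\<close>, a vector that occurs in both \<open>e 1 \<odot> e 1\<close> and \<open>e 4 \<odot> e 4\<close>; the
      components along \<open>e 5\<close> and \<open>e 6\<close> have cancelled.\<close>
    have "d22 \<cdot> e 2 + (2 * d11 - d22) \<cdot> e 3 + ((2 * d11 - d22) \<cdot> e 2 + d22 \<cdot> e 3)
        = (2 * d11) \<cdot> (e 2 + e 3)"
      by (simp add: scale_left_diff_distrib scale_right_distrib)
    then show "d \<in> derivations"
      unfolding derivation_iff[OF lin] ball_1_6
      by (simp add: form calc) (simp add: scale_right_distrib ac_simps)
  qed
qed

text \<open>The eight scalars are distributed over the two factors as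
  \<open>(d11, d22, d51, d61, d52)\<close> and \<open>(d62, d54, d64)\<close>.\<close>

lemma derivations_6_25_space:
  assumes nf: "normal_form_6_25 \<alpha> e" and two: "(2::'k) \<noteq> 0"
  shows "\<exists>\<phi> :: ('k^5) \<times> ('k^3) \<Rightarrow> 'a \<Rightarrow> 'a.
    Vector_Spaces.linear scale_prod (scale_fun scale) \<phi> \<and> bij_betw \<phi> UNIV derivations"
proof -
  interpret evolution_basis scale mult "{1..6::nat}" e
    using nf by unfold_locales (simp_all add: normal_form_6_25_def)
  \<comment> \<open>Keeps the index in \<open>e 1\<close> from being rewritten to \<open>Suc 0\<close>, which the facts below would not match.\<close>
  note One_nat_def [simp del]
  define f :: "('k^5) \<times> ('k^3) \<Rightarrow> nat \<Rightarrow> 'a" where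
    "f = (\<lambda>(v, w) i.
       if i = 1 then v$1 \<cdot> e 1 + v$3 \<cdot> e 5 + v$4 \<cdot> e 6
       else if i = 2 then v$2 \<cdot> e 2 + (2 * v$1 - v$2) \<cdot> e 3 + v$5 \<cdot> e 5 + w$1 \<cdot> e 6
       else if i = 3 then (2 * v$1 - v$2) \<cdot> e 2 + v$2 \<cdot> e 3 - v$5 \<cdot> e 5 - w$1 \<cdot> e 6
       else if i = 4 then v$1 \<cdot> e 4 + w$2 \<cdot> e 5 + w$3 \<cdot> e 6
       else if i = 5 then (2 * v$2) \<cdot> e 5
       else (2 * v$1) \<cdot> e 6)"
  show ?thesis
  proof (rule parametrization_bij[where f = f])
    fix d
    show "d \<in> derivations \<longleftrightarrow>
      Vector_Spaces.linear scale scale d \<and> (\<exists>p. \<forall>i\<in>{1..6}. d (e i) = f p i)" (is "?L \<longleftrightarrow> ?R")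
    proof
      assume d: ?L
      then have lin: "Vector_Spaces.linear scale scale d" by (simp add: derivations_def)
      obtain d11 d22 d51 d61 d52 d62 d54 d64 where form:
        "d (e 1) = d11 \<cdot> e 1 + d51 \<cdot> e 5 + d61 \<cdot> e 6"
        "d (e 2) = d22 \<cdot> e 2 + (2 * d11 - d22) \<cdot> e 3 + d52 \<cdot> e 5 + d62 \<cdot> e 6"
        "d (e 3) = (2 * d11 - d22) \<cdot> e 2 + d22 \<cdot> e 3 - d52 \<cdot> e 5 - d62 \<cdot> e 6"
        "d (e 4) = d11 \<cdot> e 4 + d54 \<cdot> e 5 + d64 \<cdot> e 6"
        "d (e 5) = (2 * d22) \<cdot> e 5" "d (e 6) = (2 * d11) \<cdot> e 6"
        using d derivations_6_25[OF nf two lin] by blast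
      obtain v :: "'k^5" where "v$1 = d11 \<and> v$2 = d22 \<and> v$3 = d51 \<and> v$4 = d61 \<and> v$5 = d52"
        using ex_vec_5[of d11 d22 d51 d61 d52] by blast
      moreover obtain w :: "'k^3" where "w$1 = d62 \<and> w$2 = d54 \<and> w$3 = d64"
        using ex_vec_3[of d62 d54 d64] by blast
      ultimately have "\<forall>i\<in>{1..6}. d (e i) = f (v, w) i"
        unfolding ball_1_6 by (simp add: f_def form)
      with lin show ?R by blast
    next
      assume ?R
      then obtain v w where lin: "Vector_Spaces.linear scale scale d"
        and eqs: "\<forall>i\<in>{1..6}. d (e i) = f (v, w) i" by (metis surj_pair)
      show ?L
        unfolding derivations_6_25[OF nf two lin]
        by (rule exI[of _ "v$1"], rule exI[of _ "v$2"], rule exI[of _ "v$3"],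
            rule exI[of _ "v$4"], rule exI[of _ "v$5"], rule exI[of _ "w$1"],
            rule exI[of _ "w$2"], rule exI[of _ "w$3"])
          (use eqs in \<open>simp add: f_def ball_1_6\<close>)
    qed
  next
    fix p q assume "\<forall>i\<in>{1..6}. f p i = f q i"
    then have "coord k (f p i) = coord k (f q i)" if "i \<in> {1..6}" for i k
      using that by simp
    \<comment> \<open>Every scalar is the coordinate of the image of some basis vector.\<close>
    from this[of 1 1] this[of 1 5] this[of 1 6] this[of 2 2] this[of 2 5] this[of 2 6]
      this[of 4 5] this[of 4 6]
    show "p = q"
      by (simp add: f_def coord_simps split_beta prod_eq_iff vec_eq_iff_5 vec_eq_iff_3)
  qed (auto simp: vector_space_scale_prod f_def scale_prod_def split_beta
      scale_left_distrib scale_left_diff_distrib scale_right_distrib scale_right_diff_distrib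
      algebra_simps)
qed

text \<open>All pairs of squares \<open>e\<^sub>1\<^sup>2, \<dots>, e\<^sub>4\<^sup>2\<close> are linearly independent here, so every off-diagonal
  entry outside the rows of \<open>e\<^sub>5\<close> and \<open>e\<^sub>6\<close> vanishes, and \<open>e\<^sub>1\<^sup>2 = e\<^sub>2 + e\<^sub>3 + e\<^sub>4\<close> determines the diagonal
  from \<open>d\<^sub>1\<^sub>1\<close>.\<close>

lemma derivations_6_26:
  assumes nf: "normal_form_6_26 e"
    and lin: "Vector_Spaces.linear scale scale d"
  shows "d \<in> derivations \<longleftrightarrow>
    (\<exists>d11 d51 d61 d52 d62 d53 d63.
      d (e 1) = d11 \<cdot> e 1 + d51 \<cdot> e 5 + d61 \<cdot> e 6 \<and>
      d (e 2) = (2 * d11) \<cdot> e 2 + d52 \<cdot> e 5 + d62 \<cdot> e 6 \<and>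
      d (e 3) = (2 * d11) \<cdot> e 3 + d53 \<cdot> e 5 + d63 \<cdot> e 6 \<and>
      d (e 4) = (2 * d11) \<cdot> e 4 - (d52 + d53) \<cdot> e 5 - (d62 + d63) \<cdot> e 6 \<and>
      d (e 5) = (4 * d11) \<cdot> e 5 \<and>
      d (e 6) = (4 * d11) \<cdot> e 6)" (is "_ \<longleftrightarrow> ?form")
proof -
  interpret evolution_basis scale mult "{1..6::nat}" e
    using nf by unfold_locales (simp_all add: normal_form_6_26_def)
  interpret d: Vector_Spaces.linear scale scale d by fact
  have sq: "e 1 \<odot> e 1 = e 2 + e 3 + e 4" "e 2 \<odot> e 2 = e 5" "e 3 \<odot> e 3 = e 6"
    "e 4 \<odot> e 4 = - (e 5 + e 6)" "e 5 \<odot> e 5 = 0" "e 6 \<odot> e 6 = 0"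
    using nf by (auto simp: normal_form_6_26_def)
  \<comment> \<open>Keeps the index in \<open>e 1\<close> from being rewritten to \<open>Suc 0\<close>, which the facts below would not match.\<close>
  note One_nat_def [simp del]
  note calc = sq coord_simps d.add d.neg d.scale d.zero
  define a where "a i j = coord i (d (e j))" for i j
  have expand: "d (e j) = a 1 j \<cdot> e 1 + a 2 j \<cdot> e 2 + a 3 j \<cdot> e 3 + a 4 j \<cdot> e 4
      + a 5 j \<cdot> e 5 + a 6 j \<cdot> e 6" for j
    using sum_coord[of "d (e j)"] by (simp add: sum_1_6 a_def)
  show ?thesis
  proof
    assume der: "d \<in> derivations"
    have diag: "coord k (d (e i \<odot> e i)) = 2 * a i i * coord k (e i \<odot> e i)"
      if "i \<in> {1..6}" for i k
      using derivation_square_coord[OF der that] by (simp only: a_def)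
    have off: "a i j * coord k (e i \<odot> e i) + a j i * coord k (e j \<odot> e j) = 0"
      if "i \<in> {1..6}" "j \<in> {1..6}" "i \<noteq> j" for i j k
      using derivation_offdiag_coord[OF der that] by (simp only: a_def)
    have z1: "a 1 2 = 0" "a 2 1 = 0" "a 1 3 = 0" "a 3 1 = 0" "a 1 4 = 0" "a 4 1 = 0"
      "a 1 5 = 0" "a 1 6 = 0"
      using off[of 1 2 2] off[of 1 2 5] off[of 1 3 2] off[of 1 3 6] off[of 1 4 2] off[of 1 4 6]
        off[of 1 5 2] off[of 1 6 2] by (simp_all add: calc)
    have z2: "a 2 3 = 0" "a 3 2 = 0" "a 4 2 = 0" "a 2 4 = 0" "a 2 5 = 0" "a 2 6 = 0"
      using off[of 2 3 5] off[of 2 3 6] off[of 2 4 6] off[of 2 4 5] off[of 2 5 5] off[of 2 6 5]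
      by (simp_all add: calc)
    have z3: "a 4 3 = 0" "a 3 4 = 0" "a 3 5 = 0" "a 3 6 = 0" "a 4 5 = 0" "a 4 6 = 0"
      using off[of 3 4 5] off[of 3 4 6] off[of 3 5 6] off[of 3 6 6] off[of 4 5 6] off[of 4 6 6]
      by (simp_all add: calc)
    have r1: "a 2 2 = 2 * a 1 1" "a 3 3 = 2 * a 1 1" "a 4 4 = 2 * a 1 1"
      using diag[of 1 2] diag[of 1 3] diag[of 1 4]
      by (simp_all add: calc a_def[symmetric] z1 z2 z3)
    have "a 5 2 + a 5 3 + a 5 4 = 0" "a 6 2 + a 6 3 + a 6 4 = 0"
      using diag[of 1 5] diag[of 1 6] by (simp_all add: calc a_def[symmetric])
    then have r4: "a 5 4 = - (a 5 2 + a 5 3)" "a 6 4 = - (a 6 2 + a 6 3)"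
      by (metis add_eq_0_iff)+
    have r5: "a 5 5 = 4 * a 1 1" "a 6 5 = 0"
      using diag[of 2 5] diag[of 2 6] r1 by (simp_all add: calc a_def[symmetric])
    have r6: "a 5 6 = 0" "a 6 6 = 4 * a 1 1"
      using diag[of 3 5] diag[of 3 6] r1 by (simp_all add: calc a_def[symmetric])
    show ?form
    proof (intro exI conjI)
      show "d (e 1) = a 1 1 \<cdot> e 1 + a 5 1 \<cdot> e 5 + a 6 1 \<cdot> e 6"
        by (simp add: expand z1)
      show "d (e 2) = (2 * a 1 1) \<cdot> e 2 + a 5 2 \<cdot> e 5 + a 6 2 \<cdot> e 6"
        by (simp add: expand z1 z2 r1)
      show "d (e 3) = (2 * a 1 1) \<cdot> e 3 + a 5 3 \<cdot> e 5 + a 6 3 \<cdot> e 6"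
        by (simp add: expand z1 z2 z3 r1)
      show "d (e 4) = (2 * a 1 1) \<cdot> e 4 - (a 5 2 + a 5 3) \<cdot> e 5 - (a 6 2 + a 6 3) \<cdot> e 6"
        unfolding expand[of 4] r4 scale_minus_left by (simp add: z1 z2 z3 r1)
      show "d (e 5) = (4 * a 1 1) \<cdot> e 5"
        by (simp add: expand z1 z2 z3 r5)
      show "d (e 6) = (4 * a 1 1) \<cdot> e 6"
        by (simp add: expand z1 z2 z3 r6)
    qed
  next
    assume ?form
    then obtain d11 d51 d61 d52 d62 d53 d63 where form:
      "d (e 1) = d11 \<cdot> e 1 + d51 \<cdot> e 5 + d61 \<cdot> e 6"
      "d (e 2) = (2 * d11) \<cdot> e 2 + d52 \<cdot> e 5 + d62 \<cdot> e 6"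
      "d (e 3) = (2 * d11) \<cdot> e 3 + d53 \<cdot> e 5 + d63 \<cdot> e 6"
      "d (e 4) = (2 * d11) \<cdot> e 4 - (d52 + d53) \<cdot> e 5 - (d62 + d63) \<cdot> e 6"
      "d (e 5) = (4 * d11) \<cdot> e 5" "d (e 6) = (4 * d11) \<cdot> e 6"
      by blast
    show "d \<in> derivations"
      unfolding derivation_iff[OF lin] ball_1_6
      by (simp add: form calc)
        (simp add: d.diff d.neg form scale_right_diff_distrib scale_right_distrib scale_left_distrib)
  qed
qed

text \<open>The seven scalars are distributed over the two factors as \<open>(d11, d51, d52, d53)\<close> and
  \<open>(d61, d62, d63)\<close>, the second collecting the coefficients along \<open>e 6\<close>.\<close>

lemma derivations_6_26_space:
  assumes nf: "normal_form_6_26 e"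
  shows "\<exists>\<phi> :: ('k^4) \<times> ('k^3) \<Rightarrow> 'a \<Rightarrow> 'a.
    Vector_Spaces.linear scale_prod (scale_fun scale) \<phi> \<and> bij_betw \<phi> UNIV derivations"
proof -
  interpret evolution_basis scale mult "{1..6::nat}" e
    using nf by unfold_locales (simp_all add: normal_form_6_26_def)
  \<comment> \<open>Keeps the index in \<open>e 1\<close> from being rewritten to \<open>Suc 0\<close>, which the facts below would not match.\<close>
  note One_nat_def [simp del]
  define f :: "('k^4) \<times> ('k^3) \<Rightarrow> nat \<Rightarrow> 'a" where
    "f = (\<lambda>(v, w) i.
       if i = 1 then v$1 \<cdot> e 1 + v$2 \<cdot> e 5 + w$1 \<cdot> e 6
       else if i = 2 then (2 * v$1) \<cdot> e 2 + v$3 \<cdot> e 5 + w$2 \<cdot> e 6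
       else if i = 3 then (2 * v$1) \<cdot> e 3 + v$4 \<cdot> e 5 + w$3 \<cdot> e 6
       else if i = 4 then (2 * v$1) \<cdot> e 4 - (v$3 + v$4) \<cdot> e 5 - (w$2 + w$3) \<cdot> e 6
       else if i = 5 then (4 * v$1) \<cdot> e 5
       else (4 * v$1) \<cdot> e 6)"
  show ?thesis
  proof (rule parametrization_bij[where f = f])
    fix d
    show "d \<in> derivations \<longleftrightarrow>
      Vector_Spaces.linear scale scale d \<and> (\<exists>p. \<forall>i\<in>{1..6}. d (e i) = f p i)" (is "?L \<longleftrightarrow> ?R")
    proof
      assume d: ?L
      then have lin: "Vector_Spaces.linear scale scale d" by (simp add: derivations_def)
      obtain d11 d51 d61 d52 d62 d53 d63 where form:
        "d (e 1) = d11 \<cdot> e 1 + d51 \<cdot> e 5 + d61 \<cdot> e 6"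
        "d (e 2) = (2 * d11) \<cdot> e 2 + d52 \<cdot> e 5 + d62 \<cdot> e 6"
        "d (e 3) = (2 * d11) \<cdot> e 3 + d53 \<cdot> e 5 + d63 \<cdot> e 6"
        "d (e 4) = (2 * d11) \<cdot> e 4 - (d52 + d53) \<cdot> e 5 - (d62 + d63) \<cdot> e 6"
        "d (e 5) = (4 * d11) \<cdot> e 5" "d (e 6) = (4 * d11) \<cdot> e 6"
        using d derivations_6_26[OF nf lin] by blast
      obtain v :: "'k^4" where "v$1 = d11 \<and> v$2 = d51 \<and> v$3 = d52 \<and> v$4 = d53"
        using ex_vec_4[of d11 d51 d52 d53] by blast
      moreover obtain w :: "'k^3" where "w$1 = d61 \<and> w$2 = d62 \<and> w$3 = d63"
        using ex_vec_3[of d61 d62 d63] by blast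
      ultimately have "\<forall>i\<in>{1..6}. d (e i) = f (v, w) i"
        unfolding ball_1_6 by (simp add: f_def form)
      with lin show ?R by blast
    next
      assume ?R
      then obtain v w where lin: "Vector_Spaces.linear scale scale d"
        and eqs: "\<forall>i\<in>{1..6}. d (e i) = f (v, w) i" by (metis surj_pair)
      show ?L
        unfolding derivations_6_26[OF nf lin]
        by (rule exI[of _ "v$1"], rule exI[of _ "v$2"], rule exI[of _ "w$1"],
            rule exI[of _ "v$3"], rule exI[of _ "w$2"], rule exI[of _ "v$4"],
            rule exI[of _ "w$3"]) (use eqs in \<open>simp add: f_def ball_1_6\<close>)
    qed
  next
    fix p q assume "\<forall>i\<in>{1..6}. f p i = f q i"
    then have "coord k (f p i) = coord k (f q i)" if "i \<in> {1..6}" for i k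
      using that by simp
    \<comment> \<open>Every scalar is the coordinate of the image of some basis vector.\<close>
    from this[of 1 1] this[of 1 5] this[of 1 6] this[of 2 5] this[of 2 6] this[of 3 5] this[of 3 6]
    show "p = q"
      by (simp add: f_def coord_simps split_beta prod_eq_iff vec_eq_iff_4 vec_eq_iff_3)
  qed (auto simp: vector_space_scale_prod f_def scale_prod_def split_beta
      scale_left_distrib scale_left_diff_distrib scale_right_distrib scale_right_diff_distrib
      algebra_simps)
qed

end

theorem mainTheorem13:
  fixes scale :: "'k::field \<Rightarrow> 'a::ab_group_add \<Rightarrow> 'a" (infixr "\<cdot>" 75)
    and mult :: "'a \<Rightarrow> 'a \<Rightarrow> 'a" (infixl "\<odot>" 70)
    and e :: "nat \<Rightarrow> 'a"
  assumes "CHAR('k) \<noteq> 2"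
    and "commutative_algebra scale mult"
    and "commutative_algebra.evolution scale mult"
    and "commutative_algebra.power_associative scale mult"
    and "commutative_algebra.nil mult"
    and "commutative_algebra.indecomposable scale mult"
    and "vector_space.dim scale (UNIV :: 'a set) \<le> 6"
    and "\<not> commutative_algebra.associative_on mult UNIV"
    and "vector_space.dim scale (commutative_algebra.ann mult) = 2"
  shows
    "(\<forall>\<alpha>. commutative_algebra.normal_form_6_25 scale mult \<alpha> e \<longrightarrow>
        (\<forall>d. Vector_Spaces.linear scale scale d \<longrightarrow>
           (d \<in> commutative_algebra.derivations scale mult \<longleftrightarrow>
             (\<exists>d11 d22 d51 d61 d52 d62 d54 d64.
                d (e 1) = d11 \<cdot> e 1 + d51 \<cdot> e 5 + d61 \<cdot> e 6 \<and>
                d (e 2) = d22 \<cdot> e 2 + (2 * d11 - d22) \<cdot> e 3 + d52 \<cdot> e 5 + d62 \<cdot> e 6 \<and>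
                d (e 3) = (2 * d11 - d22) \<cdot> e 2 + d22 \<cdot> e 3 - d52 \<cdot> e 5 - d62 \<cdot> e 6 \<and>
                d (e 4) = d11 \<cdot> e 4 + d54 \<cdot> e 5 + d64 \<cdot> e 6 \<and>
                d (e 5) = (2 * d22) \<cdot> e 5 \<and>
                d (e 6) = (2 * d11) \<cdot> e 6))) \<and>
        (\<exists>\<phi> :: ('k^5) \<times> ('k^3) \<Rightarrow> 'a \<Rightarrow> 'a.
           Vector_Spaces.linear scale_prod (scale_fun scale) \<phi> \<and>
           bij_betw \<phi> UNIV (commutative_algebra.derivations scale mult)))
     \<and>
     (commutative_algebra.normal_form_6_26 scale mult e \<longrightarrow>
        (\<forall>d. Vector_Spaces.linear scale scale d \<longrightarrow>
           (d \<in> commutative_algebra.derivations scale mult \<longleftrightarrow>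
             (\<exists>d11 d51 d61 d52 d62 d53 d63.
                d (e 1) = d11 \<cdot> e 1 + d51 \<cdot> e 5 + d61 \<cdot> e 6 \<and>
                d (e 2) = (2 * d11) \<cdot> e 2 + d52 \<cdot> e 5 + d62 \<cdot> e 6 \<and>
                d (e 3) = (2 * d11) \<cdot> e 3 + d53 \<cdot> e 5 + d63 \<cdot> e 6 \<and>
                d (e 4) = (2 * d11) \<cdot> e 4 - (d52 + d53) \<cdot> e 5 - (d62 + d63) \<cdot> e 6 \<and>
                d (e 5) = (4 * d11) \<cdot> e 5 \<and>
                d (e 6) = (4 * d11) \<cdot> e 6))) \<and>
        (\<exists>\<phi> :: ('k^4) \<times> ('k^3) \<Rightarrow> 'a \<Rightarrow> 'a.
           Vector_Spaces.linear scale_prod (scale_fun scale) \<phi> \<and>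
           bij_betw \<phi> UNIV (commutative_algebra.derivations scale mult)))"
proof -
  interpret commutative_algebra scale mult by fact
  have "(2::'k) \<noteq> 0"
  proof
    assume "(2::'k) = 0"
    then have "CHAR('k) dvd 2"
      using of_nat_eq_0_iff_char_dvd[where 'a = 'k, of 2] by simp
    then have "CHAR('k) = 1 \<or> CHAR('k) = 2"
      using two_is_prime_nat prime_nat_iff by blast
    then show False
      using assms(1) CHAR_not_1[where 'a = 'k] by simp
  qed
  then show ?thesis
    using derivations_6_25 derivations_6_25_space derivations_6_26 derivations_6_26_space
    by meson
qed

end
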